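(* For all integers $n\geq 2$, we have $$|S_n^{(2)}(123:312)|=\binom{n}{2}+1.$$
   Context: $S_n$ denotes the set of permutations $p=p(1)p(2)\cdots p(n)$ of $\{1,2,\ldots,n\}$ in one-line notation. For $p\in S_n$ and $q\in S_m$, $p$ contains $q$ as a pattern if there exist $1\leq i_1<\cdots<i_m\leq n$ such that for all $1\leq a<b\leq m$, $p(i_a)<p(i_b)$ if and only if $q(a)<q(b)$; otherwise $p$ avoids $q$. For $p\in S_n$ with $n\geq 2$, $p^{(2)}=p(2)p(3)\cdots p(n)p(1)$. For $q_1,q_2\in S_3$, $S_n^{(2)}(q_1:q_2)$ is the set of $p\in S_n$ such that $p$ avoids $q_1$ and $p^{(2)}$ avoids $q_2$. *)

theory Defs
  imports "HOL-Combinatorics.Multiset_Permutations"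
begin

text \<open>
  A permutation \<open>p\<close> in one-line notation is a list of values, so \<open>p(i)\<close> is \<open>p ! (i - 1)\<close>:
  positions are counted from 0, values from 1.
\<close>

definition perms :: "nat \<Rightarrow> nat list set" where
  "perms n = permutations_of_set {1..n}"

text \<open>
  The function \<open>f\<close> is the choice of positions \<open>i\<^sub>1 < \<dots> < i\<^sub>m\<close>.
\<close>

definition contains_pattern :: "nat list \<Rightarrow> nat list \<Rightarrow> bool" where
  "contains_pattern p q \<longleftrightarrow>
     (\<exists>f :: nat \<Rightarrow> nat.
        strict_mono_on {..<length q} f \<and>
        (\<forall>a < length q. f a < length p) \<and>
        (\<forall>a b. a < b \<and> b < length q \<longrightarrow> (p ! f a < p ! f b \<longleftrightarrow> q ! a < q ! b)))"

definition avoids :: "nat list \<Rightarrow> nat list \<Rightarrow> bool" where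
  "avoids p q \<longleftrightarrow> \<not> contains_pattern p q"

text \<open>
  \<open>rotate1 p\<close> is \<open>p\<^sup>(\<^sup>2\<^sup>) = p(2) p(3) \<dots> p(n) p(1)\<close>.
\<close>

definition S2 :: "nat \<Rightarrow> nat list \<Rightarrow> nat list \<Rightarrow> nat list set" where
  "S2 n q\<^sub>1 q\<^sub>2 = {p \<in> perms n. avoids p q\<^sub>1 \<and> avoids (rotate1 p) q\<^sub>2}"

end

theory Submission
  imports Defs
begin

text \<open>
  Let \<open>T V\<close> be the set of arrangements of a finite set \<open>V\<close> that avoid 123 and 312. If such an
  arrangement ends in \<open>l\<close>, then 312 forces the entries below \<open>l\<close> to precede those above \<open>l\<close>, and
  123 makes the entries below \<open>l\<close> decrease. If \<open>l\<close> is not the minimum, the minimum occurs among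
  them and 123 makes the entries above \<open>l\<close> decrease too, so the arrangement is determined by \<open>l\<close>;
  if \<open>l\<close> is the minimum, it can be removed. Hence \<open>|T V| = |T (V - {Min V})| + |V| - 1\<close>.
  The same argument applied to the first letter \<open>k\<close> of \<open>p\<close>, which is the last letter of
  \<open>p\<^sup>(\<^sup>2\<^sup>)\<close>, leaves one permutation for each \<open>k < n\<close> and a copy of \<open>T {1..n-1}\<close> for \<open>k = n\<close>.
\<close>

section \<open>Three-letter patterns as conditions on triples of entries\<close>

primrec avoids_triple :: "('a \<Rightarrow> 'a \<Rightarrow> 'a \<Rightarrow> bool) \<Rightarrow> 'a list \<Rightarrow> bool" where
  "avoids_triple R [] \<longleftrightarrow> True"
| "avoids_triple R (x # xs) \<longleftrightarrow> sorted_wrt (\<lambda>y z. \<not> R x y z) xs \<and> avoids_triple R xs"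

text \<open>A triple of positions has three, no, one or two entries in \<open>xs\<close>; the four
  conjuncts treat these cases in this order.\<close>

lemma avoids_triple_append:
  "avoids_triple R (xs @ ys) \<longleftrightarrow> avoids_triple R xs \<and> avoids_triple R ys \<and>
     (\<forall>x\<in>set xs. sorted_wrt (\<lambda>y z. \<not> R x y z) ys) \<and>
     (\<forall>z\<in>set ys. sorted_wrt (\<lambda>x y. \<not> R x y z) xs)"
  by (induction xs) (auto simp: sorted_wrt_append)

lemma avoids_triple_iff_nth:
  "avoids_triple R xs \<longleftrightarrow>
     (\<forall>i j k. i < j \<and> j < k \<and> k < length xs \<longrightarrow> \<not> R (xs ! i) (xs ! j) (xs ! k))"
proof (induction xs)
  case (Cons x xs)
  have "(\<forall>i j k. i < j \<and> j < k \<and> k < length (x # xs) \<longrightarrow>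
            \<not> R ((x # xs) ! i) ((x # xs) ! j) ((x # xs) ! k)) \<longleftrightarrow>
        (\<forall>j k. j < k \<and> k < length xs \<longrightarrow> \<not> R x (xs ! j) (xs ! k)) \<and>
        (\<forall>i j k. i < j \<and> j < k \<and> k < length xs \<longrightarrow> \<not> R (xs ! i) (xs ! j) (xs ! k))"
    (is "?L \<longleftrightarrow> ?R1 \<and> ?R2")
  proof (intro iffI conjI allI impI)
    fix j k assume L: ?L and "j < k \<and> k < length xs"
    then show "\<not> R x (xs ! j) (xs ! k)"
      using L[rule_format, of 0 "Suc j" "Suc k"] by simp
  next
    fix i j k assume L: ?L and "i < j \<and> j < k \<and> k < length xs"
    then show "\<not> R (xs ! i) (xs ! j) (xs ! k)"
      using L[rule_format, of "Suc i" "Suc j" "Suc k"] by simp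
  next
    fix i j k
    assume R: "?R1 \<and> ?R2" and less: "i < j \<and> j < k \<and> k < length (x # xs)"
    obtain j' k' where jk: "j = Suc j'" "k = Suc k'"
      using less by (metis less_nat_zero_code not0_implies_Suc)
    show "\<not> R ((x # xs) ! i) ((x # xs) ! j) ((x # xs) ! k)"
    proof (cases i)
      case 0
      then show ?thesis
        using R less jk by simp
    next
      case (Suc i')
      then show ?thesis
        using R less jk by simp
    qed
  qed
  then show ?case
    using Cons.IH by (auto simp: sorted_wrt_iff_nth_less)
qed simp

text \<open>A strictly monotone choice of positions on three indices amounts to three increasing
  positions.\<close>

lemma avoids_length_3:
  "avoids p [a, b, c] \<longleftrightarrow>
     avoids_triple (\<lambda>x y z. (x < y \<longleftrightarrow> a < b) \<and> (x < z \<longleftrightarrow> a < c) \<and> (y < z \<longleftrightarrow> b < c)) p"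
proof -
  have "contains_pattern p [a, b, c] \<longleftrightarrow>
    (\<exists>i j k. i < j \<and> j < k \<and> k < length p \<and>
      (p ! i < p ! j \<longleftrightarrow> a < b) \<and> (p ! i < p ! k \<longleftrightarrow> a < c) \<and> (p ! j < p ! k \<longleftrightarrow> b < c))"
    (is "?L \<longleftrightarrow> ?R")
  proof
    assume ?L
    then obtain f where f: "strict_mono_on {..<3} f" "\<forall>i<3. f i < length p"
      and *: "\<And>i j. i < j \<and> j < 3 \<Longrightarrow> p ! f i < p ! f j \<longleftrightarrow> [a, b, c] ! i < [a, b, c] ! j"
      unfolding contains_pattern_def by (auto simp: numeral_3_eq_3)
    have "f 0 < f 1" "f 1 < f 2" "f 2 < length p"
      using f by (auto simp: strict_mono_on_def)
    then show ?R
      using *[of 0 1] *[of 0 2] *[of 1 2] by auto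
  next
    assume ?R
    then obtain i j k where ijk: "i < j" "j < k" "k < length p"
      and *: "p ! i < p ! j \<longleftrightarrow> a < b" "p ! i < p ! k \<longleftrightarrow> a < c" "p ! j < p ! k \<longleftrightarrow> b < c"
      by blast
    show ?L
      unfolding contains_pattern_def
      by (rule exI[of _ "\<lambda>m. [i, j, k] ! m"])
        (use ijk * in \<open>auto simp: strict_mono_on_def less_Suc_eq\<close>)
  qed
  then show ?thesis
    unfolding avoids_def avoids_triple_iff_nth by blast
qed

definition asc3 :: "nat \<Rightarrow> nat \<Rightarrow> nat \<Rightarrow> bool" where
  "asc3 x y z \<longleftrightarrow> x < y \<and> y < z"

text \<open>
  The non-strict \<open>z \<le> x\<close> matches \<^const>\<open>contains_pattern\<close> also on lists with repeated entries.
\<close>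

definition pat312 :: "nat \<Rightarrow> nat \<Rightarrow> nat \<Rightarrow> bool" where
  "pat312 x y z \<longleftrightarrow> y < z \<and> z \<le> x"

lemma avoids_123: "avoids p [1, 2, 3] \<longleftrightarrow> avoids_triple asc3 p"
proof -
  have "asc3 = (\<lambda>x y z. (x < y \<longleftrightarrow> (1::nat) < 2) \<and> (x < z \<longleftrightarrow> (1::nat) < 3) \<and> (y < z \<longleftrightarrow> (2::nat) < 3))"
    by (auto simp: asc3_def fun_eq_iff)
  then show ?thesis
    by (simp add: avoids_length_3)
qed

lemma avoids_312: "avoids p [3, 1, 2] \<longleftrightarrow> avoids_triple pat312 p"
proof -
  have "pat312 = (\<lambda>x y z. (x < y \<longleftrightarrow> (3::nat) < 1) \<and> (x < z \<longleftrightarrow> (3::nat) < 2) \<and> (y < z \<longleftrightarrow> (1::nat) < 2))"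
    by (auto simp: pat312_def fun_eq_iff)
  then show ?thesis
    by (simp add: avoids_length_3)
qed

section \<open>Decreasing lists and two-block arrangements\<close>

definition decreasing :: "nat set \<Rightarrow> nat list" where
  "decreasing V = rev (sorted_list_of_set V)"

lemma set_decreasing [simp]: "finite V \<Longrightarrow> set (decreasing V) = V"
  by (simp add: decreasing_def)

lemma distinct_decreasing [simp]: "distinct (decreasing V)"
  by (simp add: decreasing_def)

lemma sorted_wrt_decreasing: "sorted_wrt (>) (decreasing V)"
  by (simp add: decreasing_def sorted_wrt_rev)

lemma decreasing_unique:
  assumes "sorted_wrt (>) xs"
  shows "xs = decreasing (set xs)"
proof -
  have "sorted_wrt (<) (rev xs)"
    using assms by (simp add: sorted_wrt_rev)
  then have "sorted_list_of_set (set (rev xs)) = rev xs"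
    using sorted_list_of_set.idem_if_sorted_distinct strict_sorted_iff by blast
  then show ?thesis
    by (simp add: decreasing_def)
qed

lemma sorted_wrt_decreasing_mono:
  assumes "\<And>x y. x \<in> V \<Longrightarrow> y \<in> V \<Longrightarrow> y < x \<Longrightarrow> P x y" "finite V"
  shows "sorted_wrt P (decreasing V)"
  by (rule sorted_wrt_mono_rel[OF _ sorted_wrt_decreasing]) (use assms in auto)

text \<open>Both 123 and 312 end in an ascent, so the premise on \<open>R\<close> covers them, and a
  decreasing list has no ascent.\<close>

lemma avoids_triple_if_decreasing:
  fixes xs :: "'a :: order list"
  assumes "sorted_wrt (>) xs" "\<And>x y z. R x y z \<Longrightarrow> y < z"
  shows "avoids_triple R xs"
  using assms(1)
proof (induction xs)
  case (Cons x xs)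
  have "\<not> R x y z" if "z < y" for y z
    using assms(2)[of x y z] that by auto
  then have "sorted_wrt (\<lambda>y z. \<not> R x y z) xs"
    using sorted_wrt_mono_rel[of xs "(>)"] Cons.prems by simp
  with Cons show ?case
    by simp
qed simp

lemma avoids_triple_decreasing [simp]:
  "avoids_triple asc3 (decreasing V)" "avoids_triple pat312 (decreasing V)"
  by (auto intro!: avoids_triple_if_decreasing sorted_wrt_decreasing simp: asc3_def pat312_def)

text \<open>By the premise no entry with \<open>P\<close> follows one without, so the entries with
  \<open>P\<close> form a prefix.\<close>

lemma filter_append_filter_not:
  assumes "sorted_wrt (\<lambda>x y. P y \<longrightarrow> P x) xs"
  shows "filter P xs @ filter (\<lambda>x. \<not> P x) xs = xs"
  using assms
proof (induction xs)
  case (Cons x xs)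
  then show ?case
    by (cases "P x") (auto simp: filter_empty_conv)
qed simp

text \<open>Avoidance excludes ascents only, so it yields weak descent; distinctness makes the
  descent strict.\<close>

lemma distinct_sorted_wrt_greater:
  fixes xs :: "nat list"
  assumes "sorted_wrt P xs" "distinct xs"
    and "\<And>x y. x \<in> set xs \<Longrightarrow> y \<in> set xs \<Longrightarrow> P x y \<Longrightarrow> y \<le> x"
  shows "sorted_wrt (>) xs"
proof -
  have "sorted_wrt (\<lambda>x y. P x y \<and> x \<noteq> y) xs"
    using assms(1,2) by (auto simp: sorted_wrt_iff_nth_less nth_eq_iff_index_eq)
  then show ?thesis
    by (rule sorted_wrt_mono_rel[rotated]) (use assms(3) in \<open>force simp: le_less\<close>)
qed

text \<open>The arrangement forced by a letter \<open>l\<close> at one end. The letter itself is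
  left out, so that it can be appended in one setting and prepended in the other.\<close>

definition two_blocks :: "nat set \<Rightarrow> nat \<Rightarrow> nat list" where
  "two_blocks V l = decreasing {x \<in> V. x < l} @ decreasing {x \<in> V. l < x}"

lemma set_two_blocks: "finite V \<Longrightarrow> set (two_blocks V l) = V - {l}"
  by (auto simp: two_blocks_def)

lemma distinct_two_blocks: "finite V \<Longrightarrow> distinct (two_blocks V l)"
  by (auto simp: two_blocks_def)

lemma sorted_wrt_two_blocks:
  assumes "finite V"
    and "\<And>x y. x \<in> V \<Longrightarrow> y \<in> V \<Longrightarrow> y < x \<Longrightarrow> x < l \<or> l < y \<Longrightarrow> P x y"
    and "\<And>x y. x \<in> V \<Longrightarrow> y \<in> V \<Longrightarrow> x < l \<Longrightarrow> l < y \<Longrightarrow> P x y"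
  shows "sorted_wrt P (two_blocks V l)"
  using assms
  by (auto simp: two_blocks_def sorted_wrt_append intro!: sorted_wrt_decreasing_mono)

text \<open>Every ascent runs from the first block to the second. A 123 would need two of them in a
  row; in a 312 the 3 would precede the 1, hence lie in the first block, below the 2.\<close>

lemma avoids_triple_two_blocks:
  assumes "finite V"
  shows "avoids_triple asc3 (two_blocks V l)" "avoids_triple pat312 (two_blocks V l)"
  using assms
  by (auto simp: two_blocks_def avoids_triple_append asc3_def pat312_def
      intro!: sorted_wrt_decreasing_mono)

text \<open>Serves both a last letter and a first letter \<open>l\<close>: \<open>separated\<close>
  makes the entries below \<open>l\<close> a prefix, and a decreasing block is fixed by its set of
  entries.\<close>

lemma eq_two_blocks:
  assumes "distinct xs" "set xs = V - {l}"
    and separated: "sorted_wrt (\<lambda>x y. \<not> pat312 x y l) xs"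
    and below: "sorted_wrt (>) (filter (\<lambda>x. x < l) xs)"
    and above: "sorted_wrt (>) (filter (\<lambda>x. \<not> x < l) xs)"
  shows "xs = two_blocks V l"
proof -
  \<comment> \<open>\<open>l\<close> is not an entry of \<open>xs\<close>, so failing
    \<open>x < l\<close> means \<open>l < x\<close>.\<close>
  have *: "set (filter (\<lambda>x. x < l) xs) = {x \<in> V. x < l}"
      "set (filter (\<lambda>x. \<not> x < l) xs) = {x \<in> V. l < x}"
    by (simp_all only: set_filter assms(2)) force+
  have "sorted_wrt (\<lambda>x y. y < l \<longrightarrow> x < l) xs"
    by (rule sorted_wrt_mono_rel[OF _ separated]) (auto simp: pat312_def)
  then have "xs = filter (\<lambda>x. x < l) xs @ filter (\<lambda>x. \<not> x < l) xs"
    by (rule filter_append_filter_not[symmetric])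
  also have "\<dots> = two_blocks V l"
    unfolding two_blocks_def *[symmetric]
    by (rule arg_cong2[where f = "(@)", OF decreasing_unique[OF below] decreasing_unique[OF above]])
  finally show ?thesis .
qed

section \<open>Arrangements avoiding both 123 and 312, by last letter\<close>

definition av_123_312 :: "nat set \<Rightarrow> nat list set" where
  "av_123_312 V = {xs \<in> permutations_of_set V. avoids_triple asc3 xs \<and> avoids_triple pat312 xs}"

lemma finite_av_123_312: "finite (av_123_312 V)"
  unfolding av_123_312_def by simp

text \<open>The letter \<open>m\<close> precedes all entries above \<open>l\<close>, so an ascent
  among those would complete a 123 with \<open>m\<close> as its 1.\<close>

lemma av_123_312_snoc_two_blocks:
  assumes "finite V" "ys @ [l] \<in> av_123_312 V" "m \<in> V" "m < l"
  shows "ys = two_blocks V l"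
proof (rule eq_two_blocks)
  have ys: "distinct ys" "l \<notin> set ys" "insert l (set ys) = V"
    and asc: "avoids_triple asc3 ys" "sorted_wrt (\<lambda>x y. \<not> asc3 x y l) ys"
    and pat: "sorted_wrt (\<lambda>x y. \<not> pat312 x y l) ys"
    using assms(2)
    by (auto simp: av_123_312_def permutations_of_set_def avoids_triple_append)
  show "distinct ys" "set ys = V - {l}" "sorted_wrt (\<lambda>x y. \<not> pat312 x y l) ys"
    using ys pat by auto
  \<comment> \<open>An ascent below \<open>l\<close> would form a 123 with \<open>l\<close> as its
    3.\<close>
  show "sorted_wrt (>) (filter (\<lambda>x. x < l) ys)"
    by (rule distinct_sorted_wrt_greater[OF sorted_wrt_filter[OF asc(2)]])
      (use ys in \<open>auto simp: asc3_def\<close>)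
  have "sorted_wrt (\<lambda>x y. y < l \<longrightarrow> x < l) ys"
    by (rule sorted_wrt_mono_rel[OF _ pat]) (auto simp: pat312_def)
  then have "filter (\<lambda>x. x < l) ys @ filter (\<lambda>x. \<not> x < l) ys = ys"
    by (rule filter_append_filter_not)
  then have "avoids_triple asc3 (filter (\<lambda>x. x < l) ys @ filter (\<lambda>x. \<not> x < l) ys)"
    using asc(1) by simp
  moreover have "m \<in> set (filter (\<lambda>x. x < l) ys)"
    using ys assms(3,4) by auto
  ultimately have "sorted_wrt (\<lambda>x y. \<not> asc3 m x y) (filter (\<lambda>x. \<not> x < l) ys)"
    unfolding avoids_triple_append by blast
  then show "sorted_wrt (>) (filter (\<lambda>x. \<not> x < l) ys)"
    by (rule distinct_sorted_wrt_greater) (use ys assms(4) in \<open>auto simp: asc3_def\<close>)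
qed

lemma two_blocks_snoc_in_av_123_312:
  assumes "finite V" "l \<in> V"
  shows "two_blocks V l @ [l] \<in> av_123_312 V"
  using assms
  by (auto simp: av_123_312_def permutations_of_set_def avoids_triple_append
      avoids_triple_two_blocks set_two_blocks distinct_two_blocks asc3_def pat312_def
      intro!: sorted_wrt_two_blocks)

text \<open>The last letter of 123 and of 312 exceeds an earlier one, so a final minimum takes part
  in no occurrence.\<close>

lemma snoc_Min_in_av_123_312_iff:
  assumes "finite V" "m \<in> V" "\<forall>x\<in>V. m \<le> x"
  shows "ys @ [m] \<in> av_123_312 V \<longleftrightarrow> ys \<in> av_123_312 (V - {m})"
proof -
  have "sorted_wrt (\<lambda>x y. \<not> asc3 x y m) ys" "sorted_wrt (\<lambda>x y. \<not> pat312 x y m) ys"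
    if "set ys \<subseteq> V"
    using that assms(3)
    by (auto simp: sorted_wrt_iff_nth_less asc3_def pat312_def not_less subset_iff)
  then show ?thesis
    using assms(2)
    by (auto simp: av_123_312_def permutations_of_set_def avoids_triple_append)
qed

lemma av_123_312_decomp:
  assumes "finite V" "m \<in> V" "\<forall>x\<in>V. m \<le> x"
  shows "av_123_312 V =
    (\<lambda>ys. ys @ [m]) ` av_123_312 (V - {m}) \<union> (\<lambda>l. two_blocks V l @ [l]) ` (V - {m})"
    (is "_ = ?A \<union> ?B")
proof
  show "av_123_312 V \<subseteq> ?A \<union> ?B"
  proof
    fix xs assume xs: "xs \<in> av_123_312 V"
    then have "set xs = V"
      by (simp add: av_123_312_def permutations_of_set_def)
    then obtain ys l where eq: "xs = ys @ [l]" and l: "l \<in> V"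
      using assms(2) by (cases xs rule: rev_cases) auto
    show "xs \<in> ?A \<union> ?B"
    proof (cases "l = m")
      case True
      then show ?thesis
        using xs eq snoc_Min_in_av_123_312_iff[OF assms] by auto
    next
      case False
      then have "m < l"
        using assms(3) l by fastforce
      then have "ys = two_blocks V l"
        using av_123_312_snoc_two_blocks assms(1,2) xs eq by blast
      then show ?thesis
        using eq l False by auto
    qed
  qed
  show "?A \<union> ?B \<subseteq> av_123_312 V"
    using snoc_Min_in_av_123_312_iff[OF assms] two_blocks_snoc_in_av_123_312[OF assms(1)] by auto
qed

text \<open>An arbitrary \<open>V\<close> allows the minimum to be removed without relabelling; each
  removal accounts for \<open>card V - 1\<close> further arrangements.\<close>

lemma card_av_123_312:
  "finite V \<Longrightarrow> card (av_123_312 V) = (card V choose 2) + 1"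
proof (induction "card V" arbitrary: V)
  case 0
  then have "av_123_312 V = {[]}"
    by (auto simp: av_123_312_def)
  then show ?case
    using 0 by (simp add: card_gt_0_iff)
next
  case (Suc n)
  define m where "m = Min V"
  have "V \<noteq> {}"
    using Suc.hyps(2) by auto
  then have m: "m \<in> V" "\<forall>x\<in>V. m \<le> x"
    using Suc.prems by (auto simp: m_def)
  have n: "card (V - {m}) = n"
    using Suc.hyps(2) Suc.prems m(1) by simp
  \<comment> \<open>The union is disjoint: the last letter is \<open>m\<close> in the first set and
    differs from \<open>m\<close> in the second.\<close>
  have "card (av_123_312 V) =
      card ((\<lambda>ys. ys @ [m]) ` av_123_312 (V - {m})) + card ((\<lambda>l. two_blocks V l @ [l]) ` (V - {m}))"
    by (subst av_123_312_decomp[OF Suc.prems m], rule card_Un_disjoint)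
      (use Suc.prems finite_av_123_312 in auto)
  also have "\<dots> = card (av_123_312 (V - {m})) + card (V - {m})"
    by (simp add: card_image inj_on_def)
  also have "\<dots> = (n choose 2) + 1 + n"
    using Suc.hyps(1)[of "V - {m}"] n Suc.prems by simp
  also have "\<dots> = (Suc n choose 2) + 1"
    by (simp add: numeral_2_eq_2)
  finally show ?case
    using Suc.hyps(2) by simp
qed

section \<open>The permutations to be counted, by first letter\<close>

lemma S2_123_312_Cons_iff:
  "k # xs \<in> S2 n [1, 2, 3] [3, 1, 2] \<longleftrightarrow>
     distinct xs \<and> k \<notin> set xs \<and> insert k (set xs) = {1..n} \<and>
     avoids_triple asc3 xs \<and> sorted_wrt (\<lambda>x y. \<not> asc3 k x y) xs \<and>
     avoids_triple pat312 xs \<and> sorted_wrt (\<lambda>x y. \<not> pat312 x y k) xs"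
  \<comment> \<open>\<open>k\<close> comes first in the permutation and last in its rotation, so it
    can only be the 1 of a 123 and the 2 of a 312.\<close>
  unfolding S2_def perms_def permutations_of_set_def avoids_123 avoids_312
  by (auto simp: avoids_triple_append)

text \<open>Now \<open>k\<close> as the 1 of a 123 makes the entries above it descend, while
  \<open>n\<close>, which follows all entries below \<open>k\<close>, acts as the 3 and makes those
  descend.\<close>

lemma S2_123_312_Cons_two_blocks:
  assumes "k # xs \<in> S2 n [1, 2, 3] [3, 1, 2]" "k < n"
  shows "xs = two_blocks {1..n} k"
proof (rule eq_two_blocks)
  note * = assms(1)[unfolded S2_123_312_Cons_iff]
  have xs: "distinct xs" "k \<notin> set xs" "insert k (set xs) = {1..n}"
    and asc: "avoids_triple asc3 xs" "sorted_wrt (\<lambda>x y. \<not> asc3 k x y) xs"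
    and pat: "sorted_wrt (\<lambda>x y. \<not> pat312 x y k) xs"
    using * by blast+
  show "distinct xs" "set xs = {1..n} - {k}" "sorted_wrt (\<lambda>x y. \<not> pat312 x y k) xs"
    using xs pat by auto
  show "sorted_wrt (>) (filter (\<lambda>x. \<not> x < k) xs)"
    by (rule distinct_sorted_wrt_greater[OF sorted_wrt_filter[OF asc(2)]])
      (use xs in \<open>auto simp: asc3_def\<close>)
  have "sorted_wrt (\<lambda>x y. y < k \<longrightarrow> x < k) xs"
    by (rule sorted_wrt_mono_rel[OF _ pat]) (auto simp: pat312_def)
  then have "filter (\<lambda>x. x < k) xs @ filter (\<lambda>x. \<not> x < k) xs = xs"
    by (rule filter_append_filter_not)
  then have "avoids_triple asc3 (filter (\<lambda>x. x < k) xs @ filter (\<lambda>x. \<not> x < k) xs)"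
    using asc(1) by simp
  moreover have "n \<in> set (filter (\<lambda>x. \<not> x < k) xs)"
    using xs assms(2) by auto
  ultimately have "sorted_wrt (\<lambda>x y. \<not> asc3 x y n) (filter (\<lambda>x. x < k) xs)"
    unfolding avoids_triple_append by blast
  then show "sorted_wrt (>) (filter (\<lambda>x. x < k) xs)"
    by (rule distinct_sorted_wrt_greater) (use xs assms(2) in \<open>auto simp: asc3_def\<close>)
qed

lemma Cons_two_blocks_in_S2_123_312:
  assumes "k \<in> {1..n}"
  shows "k # two_blocks {1..n} k \<in> S2 n [1, 2, 3] [3, 1, 2]"
  unfolding S2_123_312_Cons_iff using assms
  by (auto simp: avoids_triple_two_blocks set_two_blocks distinct_two_blocks asc3_def pat312_def
      intro!: sorted_wrt_two_blocks)

text \<open>A leading maximum is never the 1 of a 123, and once rotated to the end it is never the 2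
  of a 312.\<close>

lemma Cons_Max_in_S2_123_312_iff:
  assumes "n \<ge> 1"
  shows "n # xs \<in> S2 n [1, 2, 3] [3, 1, 2] \<longleftrightarrow> xs \<in> av_123_312 {1..<n}"
proof -
  have "{1..n} = insert n {1..<n}"
    using assms by auto
  then have set_iff: "n \<notin> set xs \<and> insert n (set xs) = {1..n} \<longleftrightarrow> set xs = {1..<n}"
    by (metis atLeastLessThan_iff insert_ident less_irrefl)
  have "sorted_wrt (\<lambda>x y. \<not> asc3 n x y) xs" "sorted_wrt (\<lambda>x y. \<not> pat312 x y n) xs"
    if "set xs = {1..<n}"
  proof -
    have "\<forall>x\<in>set xs. x < n"
      using that by simp
    then show "sorted_wrt (\<lambda>x y. \<not> asc3 n x y) xs" "sorted_wrt (\<lambda>x y. \<not> pat312 x y n) xs"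
      by (induction xs) (auto simp: asc3_def pat312_def)
  qed
  then show ?thesis
    unfolding S2_123_312_Cons_iff av_123_312_def permutations_of_set_def
    using set_iff by blast
qed

lemma S2_123_312_decomp:
  assumes "n \<ge> 1"
  shows "S2 n [1, 2, 3] [3, 1, 2] =
    (#) n ` av_123_312 {1..<n} \<union> (\<lambda>k. k # two_blocks {1..n} k) ` {1..<n}"
    (is "_ = ?A \<union> ?B")
proof
  show "S2 n [1, 2, 3] [3, 1, 2] \<subseteq> ?A \<union> ?B"
  proof
    fix p assume p: "p \<in> S2 n [1, 2, 3] [3, 1, 2]"
    then have "set p = {1..n}"
      by (simp add: S2_def perms_def permutations_of_set_def)
    moreover have "p \<noteq> []"
      using \<open>set p = {1..n}\<close> assms by auto
    ultimately obtain k xs where eq: "p = k # xs" and k: "k \<in> {1..n}"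
      by (cases p) (blast intro: list.set_intros)+
    show "p \<in> ?A \<union> ?B"
    proof (cases "k = n")
      case True
      then show ?thesis
        using p eq Cons_Max_in_S2_123_312_iff[OF assms] by auto
    next
      case False
      then have "k < n"
        using k by simp
      then have "xs = two_blocks {1..n} k"
        using S2_123_312_Cons_two_blocks p eq by blast
      then show ?thesis
        using eq k \<open>k < n\<close> by auto
    qed
  qed
  show "?A \<union> ?B \<subseteq> S2 n [1, 2, 3] [3, 1, 2]"
    using Cons_Max_in_S2_123_312_iff[OF assms] Cons_two_blocks_in_S2_123_312 by auto
qed

theorem proposition5p5:
  fixes n :: nat
  assumes "n \<ge> 2"
  shows "card (S2 n [1, 2, 3] [3, 1, 2]) = (n choose 2) + 1"
proof -
  have "n \<ge> 1"
    using assms by simp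
  then obtain m where m: "n = Suc m"
    by (cases n) simp_all
  have "card (S2 n [1, 2, 3] [3, 1, 2]) =
      card ((#) n ` av_123_312 {1..<n}) + card ((\<lambda>k. k # two_blocks {1..n} k) ` {1..<n})"
    unfolding S2_123_312_decomp[OF \<open>n \<ge> 1\<close>]
    by (rule card_Un_disjoint) (use finite_av_123_312 in auto)
  also have "\<dots> = card (av_123_312 {1..<n}) + card {1..<n}"
    by (simp add: card_image inj_on_def)
  \<comment> \<open>With \<open>m = n - 1\<close> letters left, the terms are
    \<open>(m choose 2) + 1\<close> and \<open>m\<close>, which Pascal's rule adds up.\<close>
  also have "\<dots> = (n choose 2) + 1"
    by (simp add: card_av_123_312 m numeral_2_eq_2)
  finally show ?thesis .
qed

end
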